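(* For every Turing degree $\mathbf{d}$ with $\mathbf{d} < \mathbf{0}'$, the class of $\Delta^0_2$ sets $A \subseteq \omega$ that have an infinite subset or an infinite cosubset (i.e., an infinite subset of $\omega \setminus A$) of Turing degree at most $\mathbf{d}$ is $\Delta^0_2$ null. Equivalently, the only $\Delta^0_2$ almost s-Ramsey degree is $\mathbf{0}'$.
   Context: A martingale is a function $M : 2^{<\omega} \to \mathbb{Q}^{\geq 0}$ such that $2M(\sigma) = M(\sigma 0) + M(\sigma 1)$ for every $\sigma \in 2^{<\omega}$. $M$ succeeds on a set $A \subseteq \omega$ if $\limsup_{n\to\infty} M(A \upharpoonright n) = \infty$; $S[M]$ denotes the class of sets on which $M$ succeeds. A class $\mathscr{C} \subseteq 2^\omega$ is $\Delta^0_2$ null if there is a martingale $M$ computable from $\emptyset'$ (a $\Delta^0_2$ martingale) with $\mathscr{C} \subseteq S[M]$. A Turing degree $\mathbf{d}$ is almost s-Ramsey if the class of $\Delta^0_2$ sets having an infinite subset or cosubset of degree at most $\mathbf{d}$ is not $\Delta^0_2$ null. (Via the limit lemma, $\Delta^0_2$ sets correspond to computable stable colorings $f:[\omega]^2\to 2$, i.e. those with $\lim_s f(x,s)$ existing for all $x$, and infinite subsets/cosubsets of $A=\{x:\lim_s f(x,s)=1\}$ correspond up to Turing degree to infinite homogeneous sets of $f$.) *)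

theory Defs
  imports "HOL-Library.Extended_Real" "HOL-Library.Liminf_Limsup" "HOL-Library.Nat_Bijection"
begin

section \<open>Partial recursive functions relative to an oracle\<close>

text \<open>
  Programs compute unary partial functions on the natural numbers; several arguments are passed
  through the Cantor pairing function \<^term>\<open>prod_encode\<close>.
\<close>

datatype prog =
    Zero | Succ | Query | Fst | Snd
  | Pairing prog prog | Comp prog prog | PRec prog prog | Mu prog

text \<open>\<open>ev X p n y\<close>: program \<open>p\<close> with oracle \<open>X\<close> halts on input \<open>n\<close> with output \<open>y\<close>.\<close>

inductive ev :: "nat set \<Rightarrow> prog \<Rightarrow> nat \<Rightarrow> nat \<Rightarrow> bool" for X where
  ev_Zero: "ev X Zero n 0"
| ev_Succ: "ev X Succ n (Suc n)"
| ev_Query: "ev X Query n (of_bool (n \<in> X))"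
| ev_Fst: "ev X Fst (prod_encode (a, b)) a"
| ev_Snd: "ev X Snd (prod_encode (a, b)) b"
| ev_Pair: "ev X p n a \<Longrightarrow> ev X q n b \<Longrightarrow> ev X (Pairing p q) n (prod_encode (a, b))"
| ev_Comp: "ev X q n m \<Longrightarrow> ev X p m y \<Longrightarrow> ev X (Comp p q) n y"
| ev_PRec_0: "ev X p a y \<Longrightarrow> ev X (PRec p q) (prod_encode (a, 0)) y"
| ev_PRec_Suc: "ev X (PRec p q) (prod_encode (a, k)) r \<Longrightarrow>
    ev X q (prod_encode (a, prod_encode (k, r))) y \<Longrightarrow>
    ev X (PRec p q) (prod_encode (a, Suc k)) y"
| ev_Mu: "ev X p (prod_encode (a, k)) 0 \<Longrightarrow>
    \<forall>i<k. \<exists>r. ev X p (prod_encode (a, i)) (Suc r) \<Longrightarrow>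
    ev X (Mu p) a k"

inductive_cases ev_elims:
  "ev X Zero n y" "ev X Succ n y" "ev X Query n y" "ev X Fst n y" "ev X Snd n y"
  "ev X (Pairing p q) n y" "ev X (Comp p q) n y" "ev X (PRec p q) n y" "ev X (Mu p) n y"

lemma ev_deterministic: "ev X p n y \<Longrightarrow> ev X p n z \<Longrightarrow> y = z"
proof (induction arbitrary: z rule: ev.induct)
  case (ev_Pair p n a q b)
  from ev_Pair.prems show ?case
    by (rule ev_elims(6)) (use ev_Pair.IH in blast)
next
  case (ev_Comp q n m p y)
  from ev_Comp.prems show ?case
    by (rule ev_elims(7)) (use ev_Comp.IH in blast)
next
  case (ev_PRec_0 p a y q)
  from ev_PRec_0.prems show ?case
    by (rule ev_elims(8)) (use ev_PRec_0.IH in \<open>simp_all add: prod_encode_eq\<close>)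
next
  case (ev_PRec_Suc p q a k r y)
  from ev_PRec_Suc.prems show ?case
    by (rule ev_elims(8)) (use ev_PRec_Suc.IH in \<open>auto simp add: prod_encode_eq\<close>)
next
  case (ev_Mu p a k)
  from ev_Mu.prems have z: "ev X p (prod_encode (a, z)) 0"
    "\<forall>i<z. \<exists>r. ev X p (prod_encode (a, i)) (Suc r)"
    by (auto elim: ev_elims(9))
  show ?case
  proof (rule linorder_cases[of k z])
    assume "k < z"
    then obtain r where "ev X p (prod_encode (a, k)) (Suc r)" using z(2) by blast
    then have "0 = Suc r" by (rule ev_Mu.IH(1))
    then show ?thesis by simp
  next
    assume "z < k"
    then obtain r where "\<forall>y. ev X p (prod_encode (a, z)) y \<longrightarrow> Suc r = y"
      using ev_Mu.IH(2) by blast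
    then have "Suc r = 0" using z(1) by blast
    then show ?thesis by simp
  qed
qed (auto elim: ev_elims simp: prod_encode_eq)

definition computable_in :: "nat set \<Rightarrow> (nat \<Rightarrow> nat) \<Rightarrow> bool" where
  "computable_in X f \<longleftrightarrow> (\<exists>p. \<forall>n. ev X p n (f n))"

definition turing_le :: "nat set \<Rightarrow> nat set \<Rightarrow> bool"  (infix "\<le>\<^sub>T" 50) where
  "A \<le>\<^sub>T B \<longleftrightarrow> computable_in B (\<lambda>n. of_bool (n \<in> A))"

definition turing_equiv :: "nat set \<Rightarrow> nat set \<Rightarrow> bool"  (infix "\<equiv>\<^sub>T" 50) where
  "A \<equiv>\<^sub>T B \<longleftrightarrow> A \<le>\<^sub>T B \<and> B \<le>\<^sub>T A"

fun subst_query :: "prog \<Rightarrow> prog \<Rightarrow> prog" where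
  "subst_query r Query = r"
| "subst_query r (Pairing p q) = Pairing (subst_query r p) (subst_query r q)"
| "subst_query r (Comp p q) = Comp (subst_query r p) (subst_query r q)"
| "subst_query r (PRec p q) = PRec (subst_query r p) (subst_query r q)"
| "subst_query r (Mu p) = Mu (subst_query r p)"
| "subst_query r p = p"

lemma ev_subst_query:
  assumes r: "\<forall>n. ev B r n (of_bool (n \<in> A))"
  shows "ev A p n y \<Longrightarrow> ev B (subst_query r p) n y"
proof (induction rule: ev.induct)
  case (ev_Mu p a k)
  then show ?case by (auto intro!: ev.ev_Mu)
qed (use r in \<open>auto intro: ev.intros\<close>)

lemma turing_le_refl: "A \<le>\<^sub>T A"
  unfolding turing_le_def computable_in_def by (blast intro: ev_Query)

lemma turing_le_trans: "A \<le>\<^sub>T B \<Longrightarrow> B \<le>\<^sub>T C \<Longrightarrow> A \<le>\<^sub>T C"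
  unfolding turing_le_def computable_in_def by (blast intro: ev_subst_query)


section \<open>The halting problem\<close>

fun prog_code :: "prog \<Rightarrow> nat" where
  "prog_code Zero = 0"
| "prog_code Succ = 1"
| "prog_code Query = 2"
| "prog_code Fst = 3"
| "prog_code Snd = 4"
| "prog_code (Pairing p q) = 4 * prod_encode (prog_code p, prog_code q) + 5"
| "prog_code (Comp p q) = 4 * prod_encode (prog_code p, prog_code q) + 6"
| "prog_code (PRec p q) = 4 * prod_encode (prog_code p, prog_code q) + 7"
| "prog_code (Mu p) = 4 * prog_code p + 8"

lemma prog_code_inject: "prog_code p = prog_code q \<longleftrightarrow> p = q"
proof
  have mod4: "4 * x \<noteq> Suc (4 * y)" "4 * x \<noteq> Suc (Suc (4 * y))" "4 * x \<noteq> 3 + 4 * y"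
    "Suc (4 * x) \<noteq> 4 * y" "Suc (Suc (4 * x)) \<noteq> 4 * y" "3 + 4 * x \<noteq> 4 * y"
    "Suc (4 * x) \<noteq> Suc (Suc (4 * y))" "Suc (Suc (4 * x)) \<noteq> 3 + 4 * y" for x y :: nat
    by presburger+
  show "prog_code p = prog_code q \<Longrightarrow> p = q"
  proof (induction p arbitrary: q)
    case Zero
    then show ?case by (cases q) auto
  next
    case Succ
    then show ?case by (cases q) auto
  next
    case Query
    then show ?case by (cases q) auto
  next
    case Fst
    then show ?case by (cases q) auto
  next
    case Snd
    then show ?case by (cases q) auto
  next
    case (Pairing p1 p2)
    then show ?case by (cases q) (auto simp: prod_encode_eq mod4)
  next
    case (Comp p1 p2)
    then show ?case by (cases q) (auto simp: prod_encode_eq mod4)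
  next
    case (PRec p1 p2)
    then show ?case by (cases q) (auto simp: prod_encode_eq mod4)
  next
    case (Mu p)
    then show ?case by (cases q) (auto simp: mod4)
  qed
qed simp

definition jump :: "nat set \<Rightarrow> nat set" where
  "jump X = {prog_code p | p. \<exists>y. ev X p (prog_code p) y}"


section \<open>Turing degrees\<close>

quotient_type turing_degree = "nat set" / turing_equiv
  by (rule equivpI)
    (auto simp: turing_equiv_def reflp_def symp_def transp_def intro: turing_le_refl turing_le_trans)

lift_definition degree_of :: "nat set \<Rightarrow> turing_degree" is "\<lambda>A. A" .

instantiation turing_degree :: order
begin

lift_definition less_eq_turing_degree :: "turing_degree \<Rightarrow> turing_degree \<Rightarrow> bool" is turing_le
  unfolding turing_equiv_def by (blast intro: turing_le_trans)

definition less_turing_degree :: "turing_degree \<Rightarrow> turing_degree \<Rightarrow> bool" where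
  "less_turing_degree d e \<longleftrightarrow> d \<le> e \<and> \<not> e \<le> d"

instance
proof
  fix x y z :: turing_degree
  show "x < y \<longleftrightarrow> x \<le> y \<and> \<not> y \<le> x" by (rule less_turing_degree_def)
  show "x \<le> x" by transfer (rule turing_le_refl)
  show "x \<le> y \<Longrightarrow> y \<le> z \<Longrightarrow> x \<le> z" by transfer (rule turing_le_trans)
  show "x \<le> y \<Longrightarrow> y \<le> x \<Longrightarrow> x = y" by transfer (simp add: turing_equiv_def)
qed

end

definition zero_jump :: turing_degree  ("\<zero>''") where
  "\<zero>' = degree_of (jump {})"

text \<open>
  As for martingales below, \<open>\<Delta>\<^sup>0\<^sub>2\<close> means computable from the halting problem.
\<close>

definition delta02 :: "nat set \<Rightarrow> bool" where
  "delta02 A \<longleftrightarrow> A \<le>\<^sub>T jump {}"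

definition delta02_degree :: "turing_degree \<Rightarrow> bool" where
  "delta02_degree d \<longleftrightarrow> (\<exists>A. delta02 A \<and> degree_of A = d)"


section \<open>Martingales\<close>

definition martingale :: "(bool list \<Rightarrow> rat) \<Rightarrow> bool" where
  "martingale M \<longleftrightarrow>
    (\<forall>\<sigma>. 0 \<le> M \<sigma>) \<and> (\<forall>\<sigma>. 2 * M \<sigma> = M (\<sigma> @ [False]) + M (\<sigma> @ [True]))"

definition initial_segment :: "nat set \<Rightarrow> nat \<Rightarrow> bool list"  (infix "\<restriction>" 80) where
  "A \<restriction> n = map (\<lambda>i. i \<in> A) [0..<n]"

definition success_set :: "(bool list \<Rightarrow> rat) \<Rightarrow> nat set set" where
  "success_set M = {A. limsup (\<lambda>n. ereal (real_of_rat (M (A \<restriction> n)))) = \<infinity>}"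

definition string_code :: "bool list \<Rightarrow> nat" where
  "string_code \<sigma> = list_encode (map of_bool \<sigma>)"

text \<open>
  A function into the nonnegative rationals is computable if a numerator and a denominator of its
  values can be computed; the fraction need not be in lowest terms.
\<close>

definition martingale_computable_in :: "nat set \<Rightarrow> (bool list \<Rightarrow> rat) \<Rightarrow> bool" where
  "martingale_computable_in X M \<longleftrightarrow>
    (\<exists>num den. computable_in X num \<and> computable_in X den \<and>
      (\<forall>\<sigma>. den (string_code \<sigma>) \<noteq> 0 \<and>
        M \<sigma> = of_nat (num (string_code \<sigma>)) / of_nat (den (string_code \<sigma>))))"

definition delta02_null :: "nat set set \<Rightarrow> bool" where
  "delta02_null C \<longleftrightarrow>
    (\<exists>M. martingale M \<and> martingale_computable_in (jump {}) M \<and> C \<subseteq> success_set M)"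


section \<open>Almost s-Ramsey degrees\<close>

definition delta02_with_subset_or_cosubset :: "turing_degree \<Rightarrow> nat set set" where
  "delta02_with_subset_or_cosubset d =
    {A. delta02 A \<and> (\<exists>B. infinite B \<and> (B \<subseteq> A \<or> B \<subseteq> - A) \<and> degree_of B \<le> d)}"

definition almost_s_Ramsey :: "turing_degree \<Rightarrow> bool" where
  "almost_s_Ramsey d \<longleftrightarrow> \<not> delta02_null (delta02_with_subset_or_cosubset d)"

end

theory Submission
  imports Defs
begin

text \<open>
  Let \<open>D\<close> be computable from the halting problem \<open>K\<close> but not conversely. The modulus \<open>m\<close> of an
  enumeration of \<open>K\<close> is computable from \<open>K\<close>, and every function dominating it computes \<open>K\<close>, so no
  \<open>D\<close>-computable function dominates \<open>m\<close>. Hence if program \<open>e\<close> with oracle \<open>D\<close> decides an infinite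
  set \<open>B\<close>, then for infinitely many \<open>x \<in> B\<close> this is already confirmed by a computation bounded by
  \<open>m x\<close>: apply non-domination to the function sending \<open>n\<close> to a bound on the computation that
  confirms some \<open>x \<ge> n\<close>, and use that \<open>m\<close> is monotone. The set \<open>S e\<close> of these \<open>x\<close> is
  \<open>K\<close>-computable uniformly in \<open>e\<close>. Staking everything on the positions in \<open>S e\<close>, on membership or on
  nonmembership, doubles the capital infinitely often along every set that includes or avoids \<open>B\<close>,
  and a weighted sum over \<open>e\<close> handles all \<open>B\<close> at once.

  Conversely, along a path that never lets its capital increase a \<open>K\<close>-computable martingale fails,
  and this path is a \<open>K\<close>-computable set.
\<close>

section \<open>Closure properties of relative computability\<close>

abbreviation pfst :: "nat \<Rightarrow> nat" where "pfst m \<equiv> fst (prod_decode m)"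
abbreviation psnd :: "nat \<Rightarrow> nat" where "psnd m \<equiv> snd (prod_decode m)"

definition decidable_in :: "nat set \<Rightarrow> (nat \<Rightarrow> bool) \<Rightarrow> bool" where
  "decidable_in X P \<longleftrightarrow> computable_in X (\<lambda>n. of_bool (P n))"

text \<open>Rules for operations take arbitrary computable functions of the input as arguments, so
  \<open>intro computable_intros\<close> follows the syntax of a term.\<close>

named_theorems computable_intros

lemma computable_in_turing_le:
  assumes "computable_in A f" "A \<le>\<^sub>T B"
  shows "computable_in B f"
  using assms unfolding turing_le_def computable_in_def by (blast intro: ev_subst_query)

lemma turing_le_iff_decidable: "A \<le>\<^sub>T B \<longleftrightarrow> decidable_in B (\<lambda>n. n \<in> A)"
  by (simp add: turing_le_def decidable_in_def)

lemma decidable_in_turing_le: "decidable_in A P \<Longrightarrow> A \<le>\<^sub>T B \<Longrightarrow> decidable_in B P"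
  unfolding decidable_in_def by (rule computable_in_turing_le)

lemma computable_compose:
  assumes "computable_in X f" "computable_in X g"
  shows "computable_in X (\<lambda>n. f (g n))"
  using assms unfolding computable_in_def by (blast intro: ev_Comp)

lemma decidable_compose:
  "decidable_in X P \<Longrightarrow> computable_in X g \<Longrightarrow> decidable_in X (\<lambda>n. P (g n))"
  unfolding decidable_in_def by (rule computable_compose)

text \<open>No constructor of \<open>prog\<close> is the identity, but every number is a pair, so
  pairing its two projections gives it back.\<close>

lemma computable_id [computable_intros]: "computable_in X (\<lambda>n. n)"
proof -
  have "ev X (Pairing Fst Snd) n n" for n
    using ev_Pair[OF ev_Fst ev_Snd, of X "pfst n" "psnd n"] by simp
  then show ?thesis unfolding computable_in_def by blast
qed

lemma computable_Suc [computable_intros]: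
  assumes "computable_in X f"
  shows "computable_in X (\<lambda>n. Suc (f n))"
  using assms unfolding computable_in_def by (blast intro: ev_Comp ev_Succ)

lemma computable_const [computable_intros]: "computable_in X (\<lambda>_. c)"
proof (induction c)
  case 0
  then show ?case unfolding computable_in_def by (blast intro: ev_Zero)
qed (rule computable_Suc)

lemma computable_prod_encode [computable_intros]:
  assumes "computable_in X f" "computable_in X g"
  shows "computable_in X (\<lambda>n. prod_encode (f n, g n))"
  using assms unfolding computable_in_def by (blast intro: ev_Pair)

lemma computable_pfst [computable_intros]:
  assumes "computable_in X f"
  shows "computable_in X (\<lambda>n. pfst (f n))"
proof -
  have "ev X Fst n (pfst n)" for n
    using ev_Fst[of X "pfst n" "psnd n"] by simp
  then show ?thesis using assms unfolding computable_in_def by (blast intro: ev_Comp)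
qed

lemma computable_psnd [computable_intros]:
  assumes "computable_in X f"
  shows "computable_in X (\<lambda>n. psnd (f n))"
proof -
  have "ev X Snd n (psnd n)" for n
    using ev_Snd[of X "pfst n" "psnd n"] by simp
  then show ?thesis using assms unfolding computable_in_def by (blast intro: ev_Comp)
qed

text \<open>The input \<open>n\<close> is kept as the parameter of \<open>PRec\<close>, so the base
  value and the step may both depend on it. The step receives its arguments in the nested pairs of
  \<open>ev_PRec_Suc\<close>.\<close>

lemma computable_rec_nat [computable_intros]:
  assumes f: "computable_in X f"
    and h: "computable_in X (\<lambda>m. h (pfst m) (pfst (psnd m)) (psnd (psnd m)))"
    and g: "computable_in X g"
  shows "computable_in X (\<lambda>n. rec_nat (f n) (\<lambda>k r. h n k r) (g n))"
proof -
  obtain p where p: "\<And>n. ev X p n (f n)" using f unfolding computable_in_def by blast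
  obtain q where q: "\<And>m. ev X q m (h (pfst m) (pfst (psnd m)) (psnd (psnd m)))"
    using h unfolding computable_in_def by blast
  have rec: "ev X (PRec p q) (prod_encode (n, k)) (rec_nat (f n) (h n) k)" for n k
  proof (induction k)
    case 0
    then show ?case by (auto intro: ev_PRec_0 p)
  next
    case (Suc k)
    then show ?case
      using q[of "prod_encode (n, prod_encode (k, rec_nat (f n) (h n) k))"]
      by (auto intro: ev_PRec_Suc)
  qed
  obtain r where r: "\<And>n. ev X r n (prod_encode (n, g n))"
    using computable_prod_encode[OF computable_id g] unfolding computable_in_def by blast
  have "ev X (Comp (PRec p q) r) n (rec_nat (f n) (h n) (g n))" for n
    using r rec by (blast intro: ev_Comp)
  then show ?thesis unfolding computable_in_def by blast
qed

section \<open>Case distinction, arithmetic, bounded quantifiers and search\<close>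

lemma computable_of_bool [computable_intros]:
  "decidable_in X P \<Longrightarrow> computable_in X (\<lambda>n. of_bool (P n))"
  by (simp add: decidable_in_def)

lemma decidable_oracle [computable_intros]:
  assumes "computable_in X f"
  shows "decidable_in X (\<lambda>n. f n \<in> X)"
  by (rule decidable_compose[OF turing_le_refl[unfolded turing_le_iff_decidable] assms])

lemma computable_if [computable_intros]:
  assumes "decidable_in X P" "computable_in X f" "computable_in X g"
  shows "computable_in X (\<lambda>n. if P n then f n else g n)"
proof -
  \<comment> \<open>The recursion makes one step or none. Inside the step the input \<open>n\<close>
    reappears as \<open>pfst m\<close>, hence the composition with \<open>f\<close>.\<close>
  have "computable_in X (\<lambda>n. rec_nat (g n) (\<lambda>k r. f n) (of_bool (P n)))"
    by (intro computable_intros assms computable_compose[OF assms(2)])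
  moreover have "rec_nat (g n) (\<lambda>k r. f n) (of_bool (P n)) = (if P n then f n else g n)" for n
    by (cases "P n") simp_all
  ultimately show ?thesis by simp
qed

lemma decidable_not [computable_intros]:
  assumes "decidable_in X P"
  shows "decidable_in X (\<lambda>n. \<not> P n)"
proof -
  have "computable_in X (\<lambda>n. if P n then 0 else 1)" by (intro computable_intros assms)
  moreover have "(\<lambda>n. of_bool (\<not> P n) :: nat) = (\<lambda>n. if P n then 0 else 1)" by auto
  ultimately show ?thesis unfolding decidable_in_def by simp
qed

lemma decidable_conj [computable_intros]:
  assumes "decidable_in X P" "decidable_in X Q"
  shows "decidable_in X (\<lambda>n. P n \<and> Q n)"
proof -
  have "computable_in X (\<lambda>n. if P n then of_bool (Q n) else 0)"
    by (intro computable_intros assms)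
  moreover have "(\<lambda>n. of_bool (P n \<and> Q n) :: nat) = (\<lambda>n. if P n then of_bool (Q n) else 0)"
    by auto
  ultimately show ?thesis unfolding decidable_in_def by simp
qed

lemma decidable_disj [computable_intros]:
  assumes "decidable_in X P" "decidable_in X Q"
  shows "decidable_in X (\<lambda>n. P n \<or> Q n)"
  using decidable_not[OF decidable_conj[OF decidable_not[OF assms(1)] decidable_not[OF assms(2)]]]
  by simp

lemma decidable_imp [computable_intros]:
  assumes "decidable_in X P" "decidable_in X Q"
  shows "decidable_in X (\<lambda>n. P n \<longrightarrow> Q n)"
  using decidable_disj[OF decidable_not[OF assms(1)] assms(2)] by (simp only: imp_conv_disj)

lemma decidable_eq_0:
  assumes "computable_in X f"
  shows "decidable_in X (\<lambda>n. f n = 0)"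
proof -
  have "computable_in X (\<lambda>n. rec_nat 1 (\<lambda>k r. 0) (f n))" by (intro computable_intros assms)
  moreover have "rec_nat 1 (\<lambda>k r. 0) m = (of_bool (m = 0) :: nat)" for m by (cases m) auto
  ultimately show ?thesis unfolding decidable_in_def by simp
qed

lemma computable_pred:
  assumes "computable_in X f"
  shows "computable_in X (\<lambda>n. f n - 1)"
proof -
  have "computable_in X (\<lambda>n. rec_nat 0 (\<lambda>k r. k) (f n))" by (intro computable_intros assms)
  moreover have "rec_nat 0 (\<lambda>k r. k) m = m - 1" for m by (cases m) auto
  ultimately show ?thesis by simp
qed

lemma computable_diff [computable_intros]:
  assumes "computable_in X f" "computable_in X g"
  shows "computable_in X (\<lambda>n. f n - g n)"
proof -
  have "computable_in X (\<lambda>n. rec_nat (f n) (\<lambda>k r. r - 1) (g n))"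
    by (intro computable_intros computable_pred assms)
  moreover have "rec_nat a (\<lambda>k r. r - 1) b = a - b" for a b :: nat by (induction b) auto
  ultimately show ?thesis by simp
qed

lemma computable_add [computable_intros]:
  assumes "computable_in X f" "computable_in X g"
  shows "computable_in X (\<lambda>n. f n + g n)"
proof -
  have "computable_in X (\<lambda>n. rec_nat (f n) (\<lambda>k r. Suc r) (g n))"
    by (intro computable_intros assms)
  moreover have "rec_nat a (\<lambda>k r. Suc r) b = a + b" for a b by (induction b) auto
  ultimately show ?thesis by simp
qed

lemma computable_sum [computable_intros]:
  assumes "computable_in X g" "computable_in X (\<lambda>m. f (pfst m) (psnd m))"
  shows "computable_in X (\<lambda>n. \<Sum>i<g n. f n i)"
proof -
  have "computable_in X (\<lambda>m. f (pfst m) (pfst (psnd m)))"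
    using computable_compose[OF assms(2), of "\<lambda>m. prod_encode (pfst m, pfst (psnd m))"]
    by (simp add: computable_intros)
  then have "computable_in X (\<lambda>n. rec_nat 0 (\<lambda>k r. r + f n k) (g n))"
    by (intro computable_intros assms)
  moreover have "rec_nat 0 (\<lambda>k r. r + f n k) b = (\<Sum>i<b. f n i)" for n b
    by (induction b) auto
  ultimately show ?thesis by simp
qed

lemma computable_mult [computable_intros]:
  assumes "computable_in X f" "computable_in X g"
  shows "computable_in X (\<lambda>n. f n * g n)"
proof -
  have "computable_in X (\<lambda>n. \<Sum>i<g n. f n)"
    by (intro computable_intros assms computable_compose[OF assms(1)])
  then show ?thesis by (simp add: mult.commute)
qed

lemma computable_prod [computable_intros]:
  assumes "computable_in X g" "computable_in X (\<lambda>m. f (pfst m) (psnd m))"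
  shows "computable_in X (\<lambda>n. \<Prod>i<g n. f n i)"
proof -
  have "computable_in X (\<lambda>m. f (pfst m) (pfst (psnd m)))"
    using computable_compose[OF assms(2), of "\<lambda>m. prod_encode (pfst m, pfst (psnd m))"]
    by (simp add: computable_intros)
  then have "computable_in X (\<lambda>n. rec_nat 1 (\<lambda>k r. r * f n k) (g n))"
    by (intro computable_intros assms)
  moreover have "rec_nat 1 (\<lambda>k r. r * f n k) b = (\<Prod>i<b. f n i)" for n b
    by (induction b) auto
  ultimately show ?thesis by simp
qed

lemma computable_power [computable_intros]:
  assumes "computable_in X f" "computable_in X g"
  shows "computable_in X (\<lambda>n. f n ^ g n)"
proof -
  have "computable_in X (\<lambda>n. \<Prod>i<g n. f n)"
    by (intro computable_intros assms computable_compose[OF assms(1)])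
  then show ?thesis by simp
qed

lemma decidable_le [computable_intros]:
  assumes "computable_in X f" "computable_in X g"
  shows "decidable_in X (\<lambda>n. f n \<le> g n)"
  using decidable_eq_0[OF computable_diff[OF assms]] by simp

lemma decidable_less [computable_intros]:
  assumes "computable_in X f" "computable_in X g"
  shows "decidable_in X (\<lambda>n. f n < g n)"
  using decidable_not[OF decidable_le[OF assms(2,1)]] by (simp add: not_le)

lemma decidable_eq [computable_intros]:
  assumes "computable_in X f" "computable_in X g"
  shows "decidable_in X (\<lambda>n. f n = g n)"
  using decidable_conj[OF decidable_le[OF assms] decidable_le[OF assms(2,1)]]
  by (simp add: order_eq_iff)

lemma decidable_bex_less [computable_intros]:
  assumes "computable_in X g" "decidable_in X (\<lambda>m. P (pfst m) (psnd m))"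
  shows "decidable_in X (\<lambda>n. \<exists>i<g n. P n i)"
proof -
  have "decidable_in X (\<lambda>n. 0 < (\<Sum>i<g n. of_bool (P n i) :: nat))"
    by (intro computable_intros assms)
  moreover have "0 < (\<Sum>i<g n. of_bool (P n i) :: nat) \<longleftrightarrow> (\<exists>i<g n. P n i)" for n
    by (auto simp: sum_nonneg_eq_0_iff zero_less_iff_neq_zero)
  ultimately show ?thesis by simp
qed

lemma decidable_ball_less [computable_intros]:
  assumes "computable_in X g" "decidable_in X (\<lambda>m. P (pfst m) (psnd m))"
  shows "decidable_in X (\<lambda>n. \<forall>i<g n. P n i)"
  using decidable_not[OF decidable_bex_less[OF assms(1) decidable_not[OF assms(2)]]] by simp

text \<open>\<open>Mu\<close> looks for a zero, so it is applied to the truth value of the negation;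
  \<open>ex\<close> makes the search total.\<close>

lemma computable_Least [computable_intros]:
  assumes P: "decidable_in X (\<lambda>m. P (pfst m) (psnd m))" and ex: "\<And>n. \<exists>k. P n k"
  shows "computable_in X (\<lambda>n. LEAST k. P n k)"
proof -
  obtain p where p: "\<And>m. ev X p m (of_bool (\<not> P (pfst m) (psnd m)))"
    using decidable_not[OF P] unfolding decidable_in_def computable_in_def by blast
  have "ev X (Mu p) n (LEAST k. P n k)" for n
  proof (rule ev_Mu)
    show "ev X p (prod_encode (n, LEAST k. P n k)) 0"
      using p[of "prod_encode (n, LEAST k. P n k)"] LeastI_ex[OF ex[of n]] by simp
    show "\<forall>i<LEAST k. P n k. \<exists>r. ev X p (prod_encode (n, i)) (Suc r)"
    proof (intro allI impI exI)
      fix i assume "i < (LEAST k. P n k)"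
      then have "\<not> P n i" by (rule not_less_Least)
      then show "ev X p (prod_encode (n, i)) (Suc 0)"
        using p[of "prod_encode (n, i)"] by simp
    qed
  qed
  then show ?thesis unfolding computable_in_def by blast
qed


section \<open>Computing with list codes\<close>

lemma computable_drop [computable_intros]:
  assumes "computable_in X f" "computable_in X g"
  shows "computable_in X (\<lambda>n. list_encode (drop (g n) (list_decode (f n))))"
proof -
  \<comment> \<open>On the code 0 of the empty list truncated subtraction leaves 0, whose second
    projection is 0 again, so taking tails needs no case distinction.\<close>
  have "prod_decode 0 = (0, 0)"
    using prod_encode_inverse[of "(0, 0)"] by (simp add: prod_encode_def)
  then have tl: "list_encode (tl (list_decode c)) = psnd (c - 1)" for c
    by (cases c) (auto split: prod.split)
  have "computable_in X (\<lambda>n. rec_nat (f n) (\<lambda>k r. psnd (r - 1)) (g n))"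
    by (intro computable_intros assms)
  moreover have "rec_nat c (\<lambda>k r. psnd (r - 1)) b = list_encode (drop b (list_decode c))" for b c
  proof (induction b)
    case (Suc b)
    then show ?case
      using tl[of "list_encode (drop b (list_decode c))"] by (simp add: drop_Suc tl_drop)
  qed auto
  ultimately show ?thesis by simp
qed

text \<open>The length is the least number of entries to drop before the code 0 of the empty list
  appears.\<close>

lemma computable_length [computable_intros]:
  assumes "computable_in X f"
  shows "computable_in X (\<lambda>n. length (list_decode (f n)))"
proof -
  have "computable_in X (\<lambda>n. LEAST k. list_encode (drop k (list_decode n)) = 0)"
  proof (intro computable_intros)
    show "\<exists>k. list_encode (drop k (list_decode n)) = 0" for n
      by (rule exI[of _ "length (list_decode n)"]) simp
  qed
  moreover have "(LEAST k. list_encode (drop k (list_decode n)) = 0) = length (list_decode n)" for n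
  proof -
    have "list_encode (drop k (list_decode n)) = 0 \<longleftrightarrow> length (list_decode n) \<le> k" for k
      using list_encode_eq[of "drop k (list_decode n)" "[]"] by simp
    then show ?thesis by (simp add: Least_equality)
  qed
  ultimately have "computable_in X (\<lambda>n. length (list_decode n))" by simp
  then show ?thesis using assms by (rule computable_compose)
qed

text \<open>Out of range, the list position read here has the value 0, unlike \<open>(!)\<close>.\<close>

definition code_nth :: "nat \<Rightarrow> nat \<Rightarrow> nat" where
  "code_nth c i = pfst (list_encode (drop i (list_decode c)) - 1)"

lemma code_nth_eq: "i < length (list_decode c) \<Longrightarrow> code_nth c i = list_decode c ! i"
  using Cons_nth_drop_Suc[of i "list_decode c", symmetric] by (simp add: code_nth_def)

lemma computable_code_nth [computable_intros]:
  assumes "computable_in X f" "computable_in X g"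
  shows "computable_in X (\<lambda>n. code_nth (f n) (g n))"
  unfolding code_nth_def by (intro computable_intros assms)

lemma decidable_bex_list [computable_intros]:
  assumes f: "computable_in X f" and P: "decidable_in X (\<lambda>m. P (pfst m) (psnd m))"
  shows "decidable_in X (\<lambda>n. \<exists>u\<in>set (list_decode (f n)). P n u)"
proof -
  have "decidable_in X (\<lambda>m. P (pfst m) (code_nth (f (pfst m)) (psnd m)))"
    using decidable_compose[OF P, of "\<lambda>m. prod_encode (pfst m, code_nth (f (pfst m)) (psnd m))"]
    by (simp add: computable_intros computable_compose[OF f])
  then have "decidable_in X (\<lambda>n. \<exists>i<length (list_decode (f n)). P n (code_nth (f n) i))"
    by (intro computable_intros f)
  moreover have "(\<exists>i<length (list_decode (f n)). P n (code_nth (f n) i)) \<longleftrightarrow>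
      (\<exists>u\<in>set (list_decode (f n)). P n u)" for n
    by (metis code_nth_eq in_set_conv_nth)
  ultimately show ?thesis by simp
qed

lemma decidable_in_list [computable_intros]:
  assumes "computable_in X f" "computable_in X g"
  shows "decidable_in X (\<lambda>n. g n \<in> set (list_decode (f n)))"
proof -
  have "decidable_in X (\<lambda>n. \<exists>u\<in>set (list_decode (f n)). u = g n)"
    by (intro computable_intros assms computable_compose[OF assms(2)])
  then show ?thesis by simp
qed

text \<open>The new code is found by search instead of recursion: its length and entries are
  decidable conditions, and they determine it because list codes are bijective.\<close>

lemma computable_snoc [computable_intros]:
  assumes "computable_in X f" "computable_in X g"
  shows "computable_in X (\<lambda>n. list_encode (list_decode (f n) @ [g n]))"
proof -
  let ?P = "\<lambda>n d. length (list_decode d) = Suc (length (list_decode (f n))) \<and>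
    (\<forall>i<length (list_decode (f n)). code_nth d i = code_nth (f n) i) \<and>
    code_nth d (length (list_decode (f n))) = g n"
  have iff: "?P n d \<longleftrightarrow> d = list_encode (list_decode (f n) @ [g n])" for n d
  proof -
    have "?P n d \<longleftrightarrow> list_decode d = list_decode (f n) @ [g n]"
      by (auto simp: code_nth_eq list_eq_iff_nth_eq nth_append less_Suc_eq)
    then show ?thesis by (metis list_decode_inverse list_encode_inverse)
  qed
  have "computable_in X (\<lambda>n. LEAST d. ?P n d)"
  proof (intro computable_intros computable_compose[OF assms(1)] computable_compose[OF assms(2)])
    show "\<exists>k. ?P n k" for n using iff by blast
  qed
  moreover have "(LEAST d. ?P n d) = list_encode (list_decode (f n) @ [g n])" for n
    unfolding iff by (rule Least_equality) auto
  ultimately show ?thesis by simp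
qed


section \<open>Derivations of halting computations\<close>

text \<open>From 5 on, the residue modulo 4 selects the constructor, and the quotient
  \<open>c\<close> is a smaller number coding the arguments. Hence statements about codes cover all
  numbers.\<close>

lemma prog_code_surj: "\<exists>p. prog_code p = e"
proof (induction e rule: less_induct)
  case (less e)
  show ?case
  proof (cases "e < 5")
    case True
    then have "e = prog_code Zero \<or> e = prog_code Succ \<or> e = prog_code Query \<or>
      e = prog_code Fst \<or> e = prog_code Snd" by auto
    then show ?thesis by metis
  next
    case False
    define c where "c = (e - 5) div 4"
    have e: "e = 4 * c + 5 \<or> e = 4 * c + 6 \<or> e = 4 * c + 7 \<or> e = 4 * c + 8"
      using False unfolding c_def by presburger
    then have "c < e" by auto
    moreover have "pfst c \<le> c" "psnd c \<le> c"
      using le_prod_encode_1[of "pfst c" "psnd c"] le_prod_encode_2[of "psnd c" "pfst c"] by simp_all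
    ultimately obtain p q r where
      "prog_code p = pfst c" "prog_code q = psnd c" "prog_code r = c"
      using less.IH by (meson le_less_trans)
    then have "prog_code (Pairing p q) = 4 * c + 5" "prog_code (Comp p q) = 4 * c + 6"
      "prog_code (PRec p q) = 4 * c + 7" "prog_code (Mu r) = 4 * c + 8" by simp_all
    then show ?thesis using e by metis
  qed
qed

abbreviation triple :: "nat \<Rightarrow> nat \<Rightarrow> nat \<Rightarrow> nat" where
  "triple e n y \<equiv> prod_encode (e, prod_encode (n, y))"

text \<open>
  \<open>ev_step X T e n y\<close>: one rule of \<^const>\<open>ev\<close> derives from the triples in \<open>T\<close> that the program
  with code \<open>e\<close> maps \<open>n\<close> to \<open>y\<close>.
\<close>

definition ev_step :: "nat set \<Rightarrow> nat set \<Rightarrow> nat \<Rightarrow> nat \<Rightarrow> nat \<Rightarrow> bool" where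
  "ev_step X T e n y \<longleftrightarrow>
    e = 0 \<and> y = 0 \<or>
    e = 1 \<and> y = Suc n \<or>
    e = 2 \<and> y = of_bool (n \<in> X) \<or>
    e = 3 \<and> y = pfst n \<or>
    e = 4 \<and> y = psnd n \<or>
    (\<exists>c<e. e = 4 * c + 5 \<and> triple (pfst c) n (pfst y) \<in> T \<and> triple (psnd c) n (psnd y) \<in> T) \<or>
    (\<exists>c<e. e = 4 * c + 6 \<and> (\<exists>m. triple (psnd c) n m \<in> T \<and> triple (pfst c) m y \<in> T)) \<or>
    (\<exists>c<e. e = 4 * c + 7 \<and> psnd n = 0 \<and> triple (pfst c) (pfst n) y \<in> T) \<or>
    (\<exists>c<e. e = 4 * c + 7 \<and> 0 < psnd n \<and>
      (\<exists>r. triple e (prod_encode (pfst n, psnd n - 1)) r \<in> T \<and>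
        triple (psnd c) (prod_encode (pfst n, prod_encode (psnd n - 1, r))) y \<in> T)) \<or>
    (\<exists>c<e. e = 4 * c + 8 \<and> triple c (prod_encode (n, y)) 0 \<in> T \<and>
      (\<forall>i<y. \<exists>r. triple c (prod_encode (n, i)) r \<in> T \<and> 0 < r))"

text \<open>The set \<open>T\<close> occurs only positively in \<open>ev_step\<close>.\<close>

lemma ev_step_mono:
  assumes "T \<subseteq> U" "ev_step X T e n y"
  shows "ev_step X U e n y"
  using assms(2) unfolding ev_step_def by (elim disj_forward) (use assms(1) in blast)+

text \<open>Codes of different constructors differ, the compound ones already modulo 4, so the shape
  of \<open>p\<close> leaves only the disjuncts that mirror its own rules of
  \<open>ev\<close>.\<close>

lemma ev_step_sound:
  assumes T: "\<And>p n y. triple (prog_code p) n y \<in> T \<Longrightarrow> ev X p n y"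
    and step: "ev_step X T (prog_code p) n y"
  shows "ev X p n y"
proof -
  have mod4: "4 * x \<noteq> Suc (4 * y)" "4 * x \<noteq> Suc (Suc (4 * y))" "4 * x \<noteq> 3 + 4 * y"
    "Suc (4 * x) \<noteq> 4 * y" "Suc (Suc (4 * x)) \<noteq> 4 * y" "3 + 4 * x \<noteq> 4 * y"
    "Suc (4 * x) \<noteq> Suc (Suc (4 * y))" "Suc (Suc (4 * x)) \<noteq> 3 + 4 * y" for x y :: nat
    by presburger+
  show ?thesis
  proof (cases p)
    case Query
    then show ?thesis using step ev_Query[of X n] by (auto simp: ev_step_def)
  next
    case Fst
    then show ?thesis using step ev_Fst[of X "pfst n" "psnd n"] by (simp add: ev_step_def)
  next
    case Snd
    then show ?thesis using step ev_Snd[of X "pfst n" "psnd n"] by (simp add: ev_step_def)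
  next
    case (Pairing q r)
    then have "ev X q n (pfst y)" "ev X r n (psnd y)"
      using step by (auto simp: ev_step_def mod4 intro: T)
    then show ?thesis using Pairing ev_Pair by fastforce
  next
    case (Comp q r)
    then show ?thesis using step by (auto simp: ev_step_def mod4 intro: T ev_Comp)
  next
    case (PRec q r)
    show ?thesis
    proof (cases "psnd n")
      case 0
      then have "ev X q (pfst n) y" using PRec step by (auto simp: ev_step_def mod4 intro: T)
      then show ?thesis using PRec 0 ev_PRec_0[of X q "pfst n" y r]
        by (metis prod.collapse prod_decode_inverse)
    next
      case (Suc k)
      then obtain s where "triple (prog_code p) (prod_encode (pfst n, k)) s \<in> T"
        "triple (prog_code r) (prod_encode (pfst n, prod_encode (k, s))) y \<in> T"
        using PRec step by (auto simp: ev_step_def mod4)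
      then have "ev X (PRec q r) (prod_encode (pfst n, Suc k)) y"
        using PRec by (blast intro: T ev_PRec_Suc)
      then show ?thesis using PRec Suc by (metis prod.collapse prod_decode_inverse)
    qed
  next
    case (Mu q)
    then have "triple (prog_code q) (prod_encode (n, y)) 0 \<in> T"
      "\<forall>i<y. \<exists>r. triple (prog_code q) (prod_encode (n, i)) r \<in> T \<and> 0 < r"
      using step by (auto simp: ev_step_def mod4)
    then have "ev X q (prod_encode (n, y)) 0" "\<forall>i<y. \<exists>r. ev X q (prod_encode (n, i)) (Suc r)"
      by (blast intro: T, metis T gr0_implies_Suc)
    then show ?thesis using Mu by (simp add: ev_Mu)
  qed (use step in \<open>auto simp: ev_step_def intro: ev.intros\<close>)
qed

text \<open>The latest conclusion comes first: extending a derivation is consing, and the triples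
  available to an entry form a suffix of the list.\<close>

fun derivation :: "nat set \<Rightarrow> nat list \<Rightarrow> bool" where
  "derivation X [] \<longleftrightarrow> True"
| "derivation X (t # ts) \<longleftrightarrow>
    ev_step X (set ts) (pfst t) (pfst (psnd t)) (psnd (psnd t)) \<and> derivation X ts"

lemma derivation_append: "derivation X ts \<Longrightarrow> derivation X us \<Longrightarrow> derivation X (ts @ us)"
  by (induction ts) (auto intro: ev_step_mono[rotated])

lemma derivation_sound:
  "derivation X ts \<Longrightarrow> triple (prog_code p) n y \<in> set ts \<Longrightarrow> ev X p n y"
proof (induction ts arbitrary: p n y)
  case (Cons t ts)
  show ?case
  proof (cases "triple (prog_code p) n y = t")
    case True
    show ?thesis
    proof (rule ev_step_sound)
      show "ev_step X (set ts) (prog_code p) n y" using Cons.prems True by auto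
    qed (use Cons in auto)
  qed (use Cons in auto)
qed simp

text \<open>Premises of one rule are derived separately, and for \<open>Mu\<close> their number is
  not fixed; concatenation merges these derivations into one.\<close>

lemma finite_subset_derivation:
  assumes "finite F" "\<forall>t\<in>F. \<exists>ts. derivation X ts \<and> t \<in> set ts"
  shows "\<exists>ts. derivation X ts \<and> F \<subseteq> set ts"
  using assms
proof (induction F)
  case empty
  then show ?case by (auto intro: exI[of _ "[]"])
next
  case (insert t F)
  then obtain ts us where "derivation X ts" "F \<subseteq> set ts" "derivation X us" "t \<in> set us"
    by auto
  then show ?case by (intro exI[of _ "ts @ us"]) (auto intro: derivation_append)
qed

lemma derivation_complete:
  "ev X p n y \<Longrightarrow> \<exists>ts. derivation X ts \<and> triple (prog_code p) n y \<in> set ts"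
proof (induction rule: ev.induct)
  \<comment> \<open>Each rule of \<open>ev\<close> becomes an instance of this: merge the
    derivations of its finitely many premises \<open>F\<close> and put the conclusion in
    front.\<close>
  have extend: "\<exists>ts. derivation X ts \<and> triple e n y \<in> set ts"
    if step: "ev_step X F e n y" and F: "finite F" "\<forall>t\<in>F. \<exists>ts. derivation X ts \<and> t \<in> set ts" for e n y F
  proof -
    obtain ts where "derivation X ts" "F \<subseteq> set ts"
      using finite_subset_derivation[OF F] by blast
    then show ?thesis
      using step by (intro exI[of _ "triple e n y # ts"]) (auto intro: ev_step_mono)
  qed
  {
    case (ev_Zero n)
    show ?case by (rule extend[of "{}"]) (auto simp: ev_step_def)
  next
    case (ev_Succ n)
    show ?case by (rule extend[of "{}"]) (auto simp: ev_step_def)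
  next
    case (ev_Query n)
    show ?case by (rule extend[of "{}"]) (auto simp: ev_step_def)
  next
    case (ev_Fst a b)
    show ?case by (rule extend[of "{}"]) (auto simp: ev_step_def)
  next
    case (ev_Snd a b)
    show ?case by (rule extend[of "{}"]) (auto simp: ev_step_def)
  next
    case (ev_Pair p n a q b)
    then show ?case
      by (intro extend[of "{triple (prog_code p) n a, triple (prog_code q) n b}"])
        (auto simp: ev_step_def)
  next
    case (ev_Comp q n m p y)
    then show ?case
      by (intro extend[of "{triple (prog_code q) n m, triple (prog_code p) m y}"])
        (auto simp: ev_step_def)
  next
    case (ev_PRec_0 p a y q)
    then show ?case
      by (intro extend[of "{triple (prog_code p) a y}"])
        (auto simp: ev_step_def)
  next
    case (ev_PRec_Suc p q a k r y)
    then show ?case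
      by (intro extend[of "{triple (prog_code (PRec p q)) (prod_encode (a, k)) r,
            triple (prog_code q) (prod_encode (a, prod_encode (k, r))) y}"])
        (auto simp: ev_step_def)
  next
    case (ev_Mu p a k)
    \<comment> \<open>The values \<open>Suc (r i)\<close> of \<open>p\<close> below \<open>k\<close>
      are fixed by a choice function, which makes the set of premises explicit and finite.\<close>
    then obtain r where r: "\<forall>i<k. \<exists>ts. derivation X ts \<and>
        triple (prog_code p) (prod_encode (a, i)) (Suc (r i)) \<in> set ts"
      by metis
    show ?case
      by (rule extend[of "insert (triple (prog_code p) (prod_encode (a, k)) 0)
            ((\<lambda>i. triple (prog_code p) (prod_encode (a, i)) (Suc (r i))) ` {..<k})"])
        (use ev_Mu.IH r in \<open>auto simp: ev_step_def\<close>)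
  }
qed

section \<open>Decidability of derivations\<close>

lemma decidable_ex_triple [computable_intros]:
  assumes f: "computable_in X f" and e: "computable_in X e" and n: "computable_in X n"
    and Q: "decidable_in X (\<lambda>m. Q (pfst m) (psnd m))"
  shows "decidable_in X (\<lambda>m. \<exists>r. triple (e m) (n m) r \<in> set (list_decode (f m)) \<and> Q m r)"
proof -
  have "decidable_in X (\<lambda>m. Q (pfst m) (psnd (psnd (psnd m))))"
    using decidable_compose[OF Q, of "\<lambda>m. prod_encode (pfst m, psnd (psnd (psnd m)))"]
    by (simp add: computable_intros)
  \<comment> \<open>A witness \<open>r\<close> can be read off an entry \<open>u\<close> of the
    list, which turns the unbounded quantifier into one over list entries.\<close>
  then have "decidable_in X (\<lambda>m. \<exists>u\<in>set (list_decode (f m)).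
      u = triple (e m) (n m) (psnd (psnd u)) \<and> Q m (psnd (psnd u)))"
    by (intro computable_intros f computable_compose[OF e] computable_compose[OF n])
  moreover have "(\<exists>u\<in>set (list_decode (f m)).
      u = triple (e m) (n m) (psnd (psnd u)) \<and> Q m (psnd (psnd u))) \<longleftrightarrow>
      (\<exists>r. triple (e m) (n m) r \<in> set (list_decode (f m)) \<and> Q m r)" for m
    by (metis prod_encode_inverse snd_conv)
  ultimately show ?thesis by simp
qed

text \<open>Recursion on the list is traded for a bounded quantifier over positions, to which the
  decidability rules apply. Position \<open>i\<close> may use only later entries, hence
  \<open>Suc i\<close>.\<close>

lemma derivation_iff_nth:
  "derivation X ts \<longleftrightarrow> (\<forall>i<length ts. ev_step X (set (drop (Suc i) ts))
    (pfst (ts ! i)) (pfst (psnd (ts ! i))) (psnd (psnd (ts ! i))))"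
  by (induction ts) (auto simp: less_Suc_eq_0_disj)

lemma decidable_derivation [computable_intros]:
  assumes "computable_in X f"
  shows "decidable_in X (\<lambda>m. derivation X (list_decode (f m)))"
proof -
  \<comment> \<open>Every quantifier in \<open>ev_step\<close> is bounded by \<open>e\<close> or
    \<open>y\<close> or asks for a triple in the list; \<open>decidable_ex_triple\<close> handles
    the last kind.\<close>
  have "decidable_in X (\<lambda>m. ev_step X (set (list_decode (pfst m)))
      (pfst (psnd m)) (pfst (psnd (psnd m))) (psnd (psnd (psnd m))))"
    unfolding ev_step_def by (intro computable_intros)
  note step = decidable_compose[OF this,
      of "\<lambda>m. prod_encode (list_encode (drop (Suc (psnd m)) (list_decode (pfst m))),
        code_nth (pfst m) (psnd m))"]
  have "decidable_in X (\<lambda>c. \<forall>i<length (list_decode c).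
      ev_step X (set (list_decode (list_encode (drop (Suc i) (list_decode c)))))
        (pfst (code_nth c i)) (pfst (psnd (code_nth c i))) (psnd (psnd (code_nth c i))))"
    by (intro computable_intros) (use step in \<open>simp add: computable_intros\<close>)
  then have "decidable_in X (\<lambda>c. derivation X (list_decode c))"
    by (simp add: derivation_iff_nth code_nth_eq cong: imp_cong)
  then show ?thesis using assms by (rule decidable_compose)
qed

text \<open>A form of Kleene's T predicate relative to \<open>X\<close>: \<open>c\<close> is a
  decidable certificate that program \<open>e\<close> maps \<open>n\<close> to
  \<open>y\<close>.\<close>

definition derives_by :: "nat set \<Rightarrow> nat \<Rightarrow> nat \<Rightarrow> nat \<Rightarrow> nat \<Rightarrow> bool" where
  "derives_by X e n y c \<longleftrightarrow>
    derivation X (list_decode c) \<and> triple e n y \<in> set (list_decode c)"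

lemma ex_derives_by_iff: "(\<exists>c. derives_by X (prog_code p) n y c) \<longleftrightarrow> ev X p n y"
  unfolding derives_by_def
  by (metis derivation_complete derivation_sound list_encode_inverse)

lemma decidable_derives_by [computable_intros]:
  assumes "computable_in X e" "computable_in X n" "computable_in X y" "computable_in X c"
  shows "decidable_in X (\<lambda>m. derives_by X (e m) (n m) (y m) (c m))"
  unfolding derives_by_def by (intro computable_intros assms)


section \<open>A modulus of the halting problem\<close>

text \<open>A stage \<open>s\<close> codes a derivation in which program \<open>x\<close> halts on
  its own code. The output is found in the derivation itself, so only \<open>s\<close> has to be
  searched for.\<close>

lemma jump_enumeration:
  obtains R where "decidable_in X (\<lambda>m. R (pfst m) (psnd m))"
    "\<And>x. x \<in> jump X \<longleftrightarrow> (\<exists>s. R x s)"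
proof
  show "decidable_in X (\<lambda>m. \<exists>y. triple (pfst m) (pfst m) y \<in> set (list_decode (psnd m)) \<and>
      derivation X (list_decode (psnd m)))"
    by (intro computable_intros)
  show "x \<in> jump X \<longleftrightarrow>
      (\<exists>s. \<exists>y. triple x x y \<in> set (list_decode s) \<and> derivation X (list_decode s))" for x
  proof -
    obtain p where p: "prog_code p = x" using prog_code_surj by blast
    have "x \<in> jump X \<longleftrightarrow> (\<exists>y. ev X p x y)"
      unfolding jump_def using p prog_code_inject by auto
    also have "\<dots> \<longleftrightarrow> (\<exists>y s. derives_by X x x y s)"
      using p by (metis ex_derives_by_iff)
    finally show ?thesis unfolding derives_by_def by blast
  qed
qed

text \<open>Take for \<open>m n\<close> the least bound on stages that reveal all elements of
  \<open>K\<close> below \<open>n\<close>. A \<open>D\<close>-computable function that is at least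
  \<open>m\<close> from some point on would bound the search for a stage and so decide
  \<open>K\<close> from \<open>D\<close>.\<close>

lemma escaping_function:
  assumes RK: "decidable_in K (\<lambda>m. R (pfst m) (psnd m))"
    and RD: "decidable_in D (\<lambda>m. R (pfst m) (psnd m))"
    and K: "\<And>x. x \<in> K \<longleftrightarrow> (\<exists>s. R x s)"
    and not_turing_le: "\<not> K \<le>\<^sub>T D"
  obtains m where "computable_in K m" "mono m"
    "\<And>f N. computable_in D f \<Longrightarrow> \<exists>n\<ge>N. f n < m n"
proof -
  let ?Q = "\<lambda>n s. \<forall>x<n. x \<in> K \<longrightarrow> (\<exists>t<s. R x t)"
  define m where "m n = (LEAST s. ?Q n s)" for n
  have ex: "\<exists>s. ?Q n s" for n
  proof (induction n)
    case (Suc n)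
    then obtain s where s: "?Q n s" by blast
    obtain t where "n \<in> K \<longrightarrow> R n t" using K by blast
    then have "?Q (Suc n) (max s (Suc t))"
      using s by (auto simp: less_Suc_eq less_max_iff_disj)
    then show ?case by blast
  qed simp
  have m: "?Q n (m n)" for n unfolding m_def using LeastI_ex[OF ex] .
  show ?thesis
  proof
    show "computable_in K m" unfolding m_def
    proof (intro computable_intros)
      show "decidable_in K (\<lambda>x. R (psnd (pfst x)) (psnd x))"
        using decidable_compose[OF RK, of "\<lambda>x. prod_encode (psnd (pfst x), psnd x)"]
        by (simp add: computable_intros)
    qed (rule ex)
    show "mono m"
    proof (rule monoI)
      fix n k :: nat assume "n \<le> k"
      then have "?Q n (m k)" using m[of k] by auto
      then show "m n \<le> m k" unfolding m_def[of n] by (rule Least_le)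
    qed
    fix f N assume f: "computable_in D f"
    show "\<exists>n\<ge>N. f n < m n"
    proof (rule ccontr)
      assume "\<not> (\<exists>n\<ge>N. f n < m n)"
      then have "m n \<le> f n" if "N \<le> n" for n using that by (meson not_le)
      \<comment> \<open>The argument \<open>Suc (x + N)\<close> exceeds \<open>x\<close>, since
        \<open>m n\<close> accounts only for elements below \<open>n\<close>, and it is at least
        \<open>N\<close>, where the domination starts.\<close>
      then have "x \<in> K \<longleftrightarrow> (\<exists>t<f (Suc (x + N)). R x t)" for x
        using m[of "Suc (x + N)"] K[of x]
        by (smt (verit) le_add2 le_Suc_eq less_add_Suc1 order_less_le_trans)
      moreover have "decidable_in D (\<lambda>x. \<exists>t<f (Suc (x + N)). R x t)"
        by (intro computable_intros computable_compose[OF f] RD)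
      ultimately show False using not_turing_le by (simp add: turing_le_iff_decidable)
    qed
  qed
qed


section \<open>Betting along a uniform family of sets\<close>

text \<open>From initial capital 1, the strategy stakes everything on the bit \<open>b\<close> at
  positions in \<open>S\<close> and abstains elsewhere.\<close>

definition capital :: "nat set \<Rightarrow> bool \<Rightarrow> bool list \<Rightarrow> nat" where
  "capital S b \<sigma> = (\<Prod>x<length \<sigma>. if x \<in> S then if \<sigma> ! x = b then 2 else 0 else 1)"

lemma capital_snoc:
  "capital S b (\<sigma> @ [c]) =
    capital S b \<sigma> * (if length \<sigma> \<in> S then if c = b then 2 else 0 else 1)"
proof -
  have "(\<Prod>x<length \<sigma>. if x \<in> S then if (\<sigma> @ [c]) ! x = b then 2 else 0 else 1) =
      capital S b \<sigma>"
    unfolding capital_def by (rule prod.cong) (auto simp: nth_append)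
  then show ?thesis by (simp add: capital_def)
qed

lemma capital_fair: "capital S b (\<sigma> @ [False]) + capital S b (\<sigma> @ [True]) = 2 * capital S b \<sigma>"
  by (cases b) (auto simp: capital_snoc)

lemma capital_before_betting: "(\<And>x. x < length \<sigma> \<Longrightarrow> x \<notin> S) \<Longrightarrow> capital S b \<sigma> = 1"
  unfolding capital_def by (rule prod.neutral) auto

lemma capital_winning:
  assumes "\<And>x. x \<in> S \<Longrightarrow> x \<in> A \<longleftrightarrow> b"
  shows "capital S b (A \<restriction> n) = 2 ^ card (S \<inter> {..<n})"
proof -
  have "capital S b (A \<restriction> n) = (\<Prod>x<n. if x \<in> S then 2 else 1)"
    unfolding capital_def using assms by (intro prod.cong) (auto simp: initial_segment_def)
  also have "\<dots> = 2 ^ card (S \<inter> {..<n})"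
    by (simp add: prod.If_cases Int_commute)
  finally show ?thesis .
qed

text \<open>
  The weighted sum of all these capitals: strategy \<open>e\<close> has weight \<open>2 ^ (- e)\<close> and bets only beyond
  position \<open>e\<close>, so that on a string of length \<open>n\<close> the strategies \<open>e \<ge> n\<close> contribute exactly
  \<open>4 / 2 ^ n\<close>. The values are multiplied by \<open>2 ^ n\<close>.
\<close>

definition total_capital :: "(nat \<Rightarrow> nat set) \<Rightarrow> bool list \<Rightarrow> nat" where
  "total_capital S \<sigma> = 4 + (\<Sum>e<length \<sigma>. 2 ^ (length \<sigma> - e) *
    (capital (S e \<inter> {e<..}) False \<sigma> + capital (S e \<inter> {e<..}) True \<sigma>))"

text \<open>Fairness gives one factor 2, the scaling by \<open>2 ^ length\<close> the other. A
  longer string also brings in one new strategy, which has not bet yet.\<close>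

lemma total_capital_fair:
  "total_capital S (\<sigma> @ [False]) + total_capital S (\<sigma> @ [True]) = 4 * total_capital S \<sigma>"
proof -
  let ?n = "length \<sigma>"
  let ?T = "\<lambda>e. S e \<inter> {e<..}"
  have last: "capital (?T ?n) b (\<sigma> @ [c]) = 1" for b c
    by (rule capital_before_betting) auto
  have summand: "2 ^ (Suc ?n - e) * (capital (?T e) False (\<sigma> @ [False]) + capital (?T e) True (\<sigma> @ [False]))
      + 2 ^ (Suc ?n - e) * (capital (?T e) False (\<sigma> @ [True]) + capital (?T e) True (\<sigma> @ [True]))
      = 4 * (2 ^ (?n - e) * (capital (?T e) False \<sigma> + capital (?T e) True \<sigma>))"
    if "e < ?n" for e
  proof -
    have pow: "(2::nat) ^ (Suc ?n - e) = 2 * 2 ^ (?n - e)"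
      using that by (simp add: Suc_diff_le)
    have "2 ^ (Suc ?n - e) * (capital (?T e) False (\<sigma> @ [False]) + capital (?T e) True (\<sigma> @ [False]))
        + 2 ^ (Suc ?n - e) * (capital (?T e) False (\<sigma> @ [True]) + capital (?T e) True (\<sigma> @ [True]))
        = 2 ^ (Suc ?n - e) * ((capital (?T e) False (\<sigma> @ [False]) + capital (?T e) False (\<sigma> @ [True]))
          + (capital (?T e) True (\<sigma> @ [False]) + capital (?T e) True (\<sigma> @ [True])))"
      by (simp add: algebra_simps)
    also have "\<dots> = 4 * (2 ^ (?n - e) * (capital (?T e) False \<sigma> + capital (?T e) True \<sigma>))"
      unfolding capital_fair pow by (simp add: algebra_simps)
    finally show ?thesis .
  qed
  \<comment> \<open>The 16 consists of the constant 4 from each string and, again from each string,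
    weight 2 times the two unit capitals of the new strategy.\<close>
  have "total_capital S (\<sigma> @ [False]) + total_capital S (\<sigma> @ [True]) = 16 +
      (\<Sum>e<?n. 2 ^ (Suc ?n - e) * (capital (?T e) False (\<sigma> @ [False]) + capital (?T e) True (\<sigma> @ [False]))
      + 2 ^ (Suc ?n - e) * (capital (?T e) False (\<sigma> @ [True]) + capital (?T e) True (\<sigma> @ [True])))"
    unfolding total_capital_def by (simp add: last sum.distrib)
  also have "\<dots> = 16 + (\<Sum>e<?n. 4 * (2 ^ (?n - e) * (capital (?T e) False \<sigma> + capital (?T e) True \<sigma>)))"
    using summand by (intro arg_cong2[where f = "(+)"] sum.cong) auto
  also have "\<dots> = 4 * total_capital S \<sigma>"
    unfolding total_capital_def by (simp add: sum_distrib_left)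
  finally show ?thesis .
qed

lemma list_decode_string_code [simp]: "list_decode (string_code \<sigma>) = map of_bool \<sigma>"
  by (simp add: string_code_def)

lemma limsup_eq_infinity:
  fixes f :: "nat \<Rightarrow> rat"
  assumes "\<And>k. \<exists>N. \<forall>n\<ge>N. of_nat k \<le> f n"
  shows "limsup (\<lambda>n. ereal (real_of_rat (f n))) = \<infinity>"
proof -
  have "(\<lambda>n. ereal (real_of_rat (f n))) \<longlonglongrightarrow> \<infinity>"
    unfolding tendsto_PInfty eventually_sequentially
  proof
    fix r
    obtain k where k: "r < real k" using reals_Archimedean2 by blast
    obtain N where N: "\<And>n. n \<ge> N \<Longrightarrow> of_nat k \<le> f n" using assms by blast
    have "ereal r < ereal (real_of_rat (f n))" if "n \<ge> N" for n
    proof -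
      have "real k \<le> real_of_rat (f n)" using N[OF that] of_rat_less_eq[of "of_nat k" "f n"] by simp
      then show ?thesis using k by simp
    qed
    then show "\<exists>N. \<forall>n\<ge>N. ereal r < ereal (real_of_rat (f n))" by blast
  qed
  then show ?thesis by (simp add: lim_imp_Limsup)
qed

text \<open>With the right \<open>b\<close>, strategy \<open>e\<close> wins every bet, so its
  capital never falls and grows without bound; all other summands are nonnegative.\<close>

lemma total_capital_succeeds:
  assumes inf: "infinite (S e)" and A: "S e \<subseteq> A \<or> S e \<subseteq> - A"
  shows "A \<in> success_set (\<lambda>\<sigma>. of_nat (total_capital S \<sigma>) / of_nat (2 ^ length \<sigma>))"
  unfolding success_set_def mem_Collect_eq
proof (rule limsup_eq_infinity)
  fix k
  define T where "T = S e \<inter> {e<..}"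
  have "S e \<subseteq> T \<union> {..e}" unfolding T_def by auto
  then have "infinite T" using inf by (meson finite_Un finite_atMost finite_subset)
  \<comment> \<open>Since \<open>k < 2 ^ k\<close>, winning \<open>k\<close> bets suffices to exceed
    \<open>k\<close>; the \<open>e\<close> further bets offset the weight
    \<open>2 ^ (- e)\<close>.\<close>
  then obtain F where F: "F \<subseteq> T" "finite F" "card F = k + e"
    using infinite_arbitrarily_large by blast
  then obtain N where N: "F \<subseteq> {..<N}" using finite_nat_iff_bounded by blast
  obtain b where b: "\<And>x. x \<in> T \<Longrightarrow> x \<in> A \<longleftrightarrow> b" using A unfolding T_def by blast
  have "of_nat k \<le> of_nat (total_capital S (A \<restriction> n)) / (of_nat (2 ^ length (A \<restriction> n)) :: rat)"
    if n: "n \<ge> max N (Suc e)" for n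
  proof -
    have len: "length (A \<restriction> n) = n" by (simp add: initial_segment_def)
    have "k + e \<le> card (T \<inter> {..<n})"
      using F N n by (metis (no_types, lifting) Int_subset_iff card_mono finite_Int finite_lessThan
          lessThan_subset_iff max.bounded_iff order_trans)
    then have "2 ^ (k + e) \<le> capital T b (A \<restriction> n)"
      using capital_winning[of T A b n] b by (simp add: power_increasing)
    also have "\<dots> \<le> capital T False (A \<restriction> n) + capital T True (A \<restriction> n)" by (cases b) auto
    finally have "2 ^ (n - e) * 2 ^ (k + e) \<le>
        2 ^ (n - e) * (capital T False (A \<restriction> n) + capital T True (A \<restriction> n))" by simp
    \<comment> \<open>This needs \<open>e < n\<close>: strategy \<open>e\<close> is a summand only
      on strings longer than \<open>e\<close>.\<close>
    also have "\<dots> \<le> (\<Sum>e<n. 2 ^ (n - e) *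
        (capital (S e \<inter> {e<..}) False (A \<restriction> n) + capital (S e \<inter> {e<..}) True (A \<restriction> n)))"
      unfolding T_def using n by (intro member_le_sum) auto
    also have "\<dots> \<le> total_capital S (A \<restriction> n)" unfolding total_capital_def len by simp
    also have "(2::nat) ^ (n - e) * 2 ^ (k + e) = 2 ^ k * 2 ^ n"
      using n by (simp flip: power_add)
    finally have "k * 2 ^ n \<le> total_capital S (A \<restriction> n)"
      using less_exp[of k] by (meson le_trans less_imp_le mult_le_mono1)
    then have "of_nat (k * 2 ^ n) \<le> (of_nat (total_capital S (A \<restriction> n)) :: rat)"
      by (rule of_nat_mono)
    then show ?thesis unfolding len by (simp add: field_simps)
  qed
  then show "\<exists>N. \<forall>n\<ge>N. of_nat k \<le>
      of_nat (total_capital S (A \<restriction> n)) / (of_nat (2 ^ length (A \<restriction> n)) :: rat)" by blast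
qed

lemma computable_total_capital:
  assumes S: "decidable_in X (\<lambda>m. psnd m \<in> S (pfst m))"
  obtains num where "computable_in X num" "\<And>\<sigma>. num (string_code \<sigma>) = total_capital S \<sigma>"
proof -
  define cap where "cap c e v = (\<Prod>x<length (list_decode c).
    if x \<in> S e \<and> e < x then if code_nth c x = v then 2 else 0 else (1::nat))" for c e v
  define num where "num c = 4 + (\<Sum>e<length (list_decode c). 2 ^ (length (list_decode c) - e) *
    (cap c e 0 + cap c e 1))" for c
  have cap_eq: "cap (string_code \<sigma>) e (of_bool b) = capital (S e \<inter> {e<..}) b \<sigma>" for \<sigma> e b
    unfolding cap_def capital_def by (intro prod.cong) (auto simp: code_nth_eq)
  show ?thesis
  proof
    have "decidable_in X (\<lambda>x. psnd x \<in> S (psnd (pfst x)))"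
      using decidable_compose[OF S, of "\<lambda>x. prod_encode (psnd (pfst x), psnd x)"]
      by (simp add: computable_intros)
    then show "computable_in X num"
      unfolding num_def cap_def by (intro computable_intros)
    show "num (string_code \<sigma>) = total_capital S \<sigma>" for \<sigma>
      using cap_eq[of \<sigma> _ False] cap_eq[of \<sigma> _ True] by (simp add: num_def total_capital_def)
  qed
qed

text \<open>Decidability uniform in \<open>e\<close> allows a single computable martingale to run
  all strategies.\<close>

lemma computable_martingale_uniform_family:
  assumes "decidable_in X (\<lambda>m. psnd m \<in> S (pfst m))"
  obtains M where "martingale M" "martingale_computable_in X M"
    "\<And>A e. infinite (S e) \<Longrightarrow> S e \<subseteq> A \<or> S e \<subseteq> - A \<Longrightarrow> A \<in> success_set M"
proof
  let ?M = "\<lambda>\<sigma>. of_nat (total_capital S \<sigma>) / (of_nat (2 ^ length \<sigma>) :: rat)"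
  show "martingale ?M"
    unfolding martingale_def
  proof (intro conjI allI)
    fix \<sigma>
    have "4 * of_nat (total_capital S \<sigma>) =
        (of_nat (total_capital S (\<sigma> @ [False])) + of_nat (total_capital S (\<sigma> @ [True])) :: rat)"
      using arg_cong[OF total_capital_fair[of S \<sigma>], of "of_nat :: nat \<Rightarrow> rat"] by simp
    then show "2 * ?M \<sigma> = ?M (\<sigma> @ [False]) + ?M (\<sigma> @ [True])" by (simp add: field_simps)
  qed simp
  show "martingale_computable_in X ?M"
  proof -
    obtain num where "computable_in X num" "\<And>\<sigma>. num (string_code \<sigma>) = total_capital S \<sigma>"
      using computable_total_capital[OF assms] by blast
    moreover have "computable_in X (\<lambda>c. 2 ^ length (list_decode c))" by (intro computable_intros)
    ultimately show ?thesis
      unfolding martingale_computable_in_def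
      by (intro exI[of _ num] exI[of _ "\<lambda>c. 2 ^ length (list_decode c)"]) simp
  qed
qed (rule total_capital_succeeds)


section \<open>Degrees strictly below the halting problem\<close>

lemma turing_below_jump_null:
  assumes le: "D \<le>\<^sub>T jump {}" and not_ge: "\<not> jump {} \<le>\<^sub>T D"
  shows "delta02_null {A. \<exists>B. infinite B \<and> (B \<subseteq> A \<or> B \<subseteq> - A) \<and> B \<le>\<^sub>T D}"
proof -
  obtain R where R: "decidable_in {} (\<lambda>m. R (pfst m) (psnd m))"
    "\<And>x. x \<in> jump {} \<longleftrightarrow> (\<exists>s. R x s)"
    using jump_enumeration by blast
  \<comment> \<open>The enumeration of the halting problem uses no oracle, so it is decidable
    relative to \<open>D\<close> as well as to \<open>jump {}\<close>.\<close>
  have "{} \<le>\<^sub>T X" for X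
    unfolding turing_le_def by (simp add: computable_const)
  then have "decidable_in X (\<lambda>m. R (pfst m) (psnd m))" for X
    using R(1) decidable_in_turing_le by blast
  then obtain m where m: "computable_in (jump {}) m" "mono m"
    "\<And>f N. computable_in D f \<Longrightarrow> \<exists>n\<ge>N. f n < m n"
    using escaping_function[of "jump {}" R D] R(2) not_ge by blast
  define S where "S e = {x. \<exists>c<m x. derives_by D e x 1 c}" for e
  \<comment> \<open>Certificates refer to the oracle \<open>D\<close>, so they are checked from
    \<open>D\<close> first; \<open>le\<close> then transfers this to \<open>jump {}\<close>, which
    also computes the bound \<open>m\<close>.\<close>
  have "decidable_in D (\<lambda>z. derives_by D (pfst (pfst z)) (psnd (pfst z)) 1 (psnd z))"
    by (intro computable_intros)
  then have "decidable_in (jump {}) (\<lambda>z. derives_by D (pfst (pfst z)) (psnd (pfst z)) 1 (psnd z))"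
    using le by (rule decidable_in_turing_le)
  then have "decidable_in (jump {}) (\<lambda>z. \<exists>c<m (psnd z). derives_by D (pfst z) (psnd z) 1 c)"
    by (intro computable_intros computable_compose[OF m(1)])
  then have "decidable_in (jump {}) (\<lambda>z. psnd z \<in> S (pfst z))" by (simp add: S_def)
  then obtain M where M: "martingale M" "martingale_computable_in (jump {}) M"
    "\<And>A e. infinite (S e) \<Longrightarrow> S e \<subseteq> A \<or> S e \<subseteq> - A \<Longrightarrow> A \<in> success_set M"
    using computable_martingale_uniform_family by blast
  have S: "\<exists>e. infinite (S e) \<and> S e \<subseteq> B" if B: "infinite B" "B \<le>\<^sub>T D" for B
  proof -
    obtain p where p: "\<And>x. ev D p x (of_bool (x \<in> B))"
      using B(2) unfolding turing_le_def computable_in_def by blast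
    let ?e = "prog_code p"
    have derives: "(\<exists>c. derives_by D ?e x 1 c) \<longleftrightarrow> x \<in> B" for x
      unfolding ex_derives_by_iff using p[of x] ev_deterministic[OF p[of x], of 1]
      by (cases "x \<in> B") (simp, force)
    \<comment> \<open>One number codes both an element of \<open>B\<close> that is at least
      \<open>n\<close> and its certificate; the search succeeds because \<open>B\<close> is
      infinite.\<close>
    define h where "h n = (LEAST z. n \<le> pfst z \<and> derives_by D ?e (pfst z) 1 (psnd z))" for n
    have ex: "\<exists>z. n \<le> pfst z \<and> derives_by D ?e (pfst z) 1 (psnd z)" for n
    proof -
      obtain x where "n \<le> x" "x \<in> B" using B(1) infinite_nat_iff_unbounded_le by blast
      then obtain c where "derives_by D ?e x 1 c" using derives by blast
      then show ?thesis using \<open>n \<le> x\<close> by (intro exI[of _ "prod_encode (x, c)"]) simp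
    qed
    have h: "n \<le> pfst (h n)" "derives_by D ?e (pfst (h n)) 1 (psnd (h n))" for n
      using LeastI_ex[OF ex[of n]] unfolding h_def by auto
    have "computable_in D h" unfolding h_def by (intro computable_intros) (rule ex)
    have "\<exists>x\<ge>N. x \<in> S ?e" for N
    proof -
      obtain n where n: "n \<ge> N" "h n < m n" using m(3)[OF \<open>computable_in D h\<close>] by blast
      \<comment> \<open>A certificate is at most the pair containing it, and monotonicity of
        \<open>m\<close> carries the bound from \<open>n\<close> to the element found.\<close>
      have "psnd (h n) \<le> h n" using le_prod_encode_2[of "psnd (h n)" "pfst (h n)"] by simp
      also have "\<dots> < m n" by (rule n(2))
      also have "m n \<le> m (pfst (h n))" using m(2) h(1) by (rule monoD)
      finally have "pfst (h n) \<in> S ?e" unfolding S_def using h(2) by blast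
      then show ?thesis using n(1) h(1) le_trans by blast
    qed
    then have "infinite (S ?e)" unfolding infinite_nat_iff_unbounded_le by blast
    moreover have "S ?e \<subseteq> B" unfolding S_def using derives by blast
    ultimately show ?thesis by blast
  qed
  \<comment> \<open>The infinite set \<open>S e\<close> lies on the same side of \<open>A\<close> as
    the set \<open>B\<close> that contains it.\<close>
  have "{A. \<exists>B. infinite B \<and> (B \<subseteq> A \<or> B \<subseteq> - A) \<and> B \<le>\<^sub>T D} \<subseteq> success_set M"
    using S M(3) by (smt (verit) mem_Collect_eq subsetI subset_trans)
  then show ?thesis unfolding delta02_null_def using M(1,2) by blast
qed


section \<open>The degree of the halting problem\<close>

text \<open>By fairness one of the two successors of a string has no more capital than the string.
  Always moving to such a successor keeps the capital at most \<open>M []\<close>.\<close>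

lemma computable_martingale_fails:
  assumes M: "martingale M" "martingale_computable_in X M"
  obtains A where "A \<le>\<^sub>T X" "A \<notin> success_set M"
proof -
  obtain num den where nd: "computable_in X num" "computable_in X den"
    "\<And>\<sigma>. den (string_code \<sigma>) \<noteq> 0"
    "\<And>\<sigma>. M \<sigma> = of_nat (num (string_code \<sigma>)) / of_nat (den (string_code \<sigma>))"
    using M(2) unfolding martingale_computable_in_def by blast
  define ext where "ext c b = list_encode (list_decode c @ [b])" for c b
  \<comment> \<open>Cross-multiplied fractions: take the bit 1 exactly when this does not raise the
    capital.\<close>
  define bit where "bit c = (num (ext c 1) * den c \<le> num c * den (ext c 1))" for c
  \<comment> \<open>The initial value 0 is the code of the empty string.\<close>
  define path where "path = rec_nat 0 (\<lambda>_ c. ext c (of_bool (bit c)))"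
  define A where "A = {n. bit (path n)}"
  have ext_code: "ext (string_code \<sigma>) (of_bool b) = string_code (\<sigma> @ [b])" for \<sigma> b
    by (simp add: ext_def string_code_def)
  have bit_iff: "bit (string_code \<sigma>) \<longleftrightarrow> M (\<sigma> @ [True]) \<le> M \<sigma>" for \<sigma>
  proof -
    let ?c = "string_code \<sigma>" and ?d = "string_code (\<sigma> @ [True])"
    have "M (\<sigma> @ [True]) \<le> M \<sigma> \<longleftrightarrow>
        (of_nat (num ?d * den ?c) :: rat) \<le> of_nat (num ?c * den ?d)"
      unfolding nd(4) using nd(3)[of \<sigma>] nd(3)[of "\<sigma> @ [True]"] by (simp add: field_simps)
    also have "\<dots> \<longleftrightarrow> bit ?c" unfolding bit_def using ext_code[of \<sigma> True]
      by (simp only: of_nat_le_iff) simp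
    finally show ?thesis by simp
  qed
  have A_Suc: "A \<restriction> Suc n = (A \<restriction> n) @ [n \<in> A]" for n
    by (simp add: initial_segment_def)
  have path: "path n = string_code (A \<restriction> n)" for n
  proof (induction n)
    case 0
    then show ?case by (simp add: path_def initial_segment_def string_code_def)
  next
    case (Suc n)
    have "path (Suc n) = ext (path n) (of_bool (n \<in> A))" by (simp add: path_def A_def)
    then show ?case unfolding A_Suc Suc by (simp only: ext_code)
  qed
  have "n \<in> A \<longleftrightarrow> bit (path n)" for n by (simp add: A_def)
  then have in_A_iff: "n \<in> A \<longleftrightarrow> M (A \<restriction> n @ [True]) \<le> M (A \<restriction> n)" for n
    by (simp only: path bit_iff)
  have bound: "M (A \<restriction> n) \<le> M []" for n
  proof (induction n)
    case 0
    then show ?case by (simp add: initial_segment_def)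
  next
    case (Suc n)
    have "M (A \<restriction> n @ [n \<in> A]) \<le> M (A \<restriction> n)"
    proof (cases "n \<in> A")
      case True
      then show ?thesis using in_A_iff[of n] by simp
    next
      case False
      \<comment> \<open>If the bit 1 raises the capital, fairness forces the bit 0 to lower
        it.\<close>
      then have "M (A \<restriction> n) < M (A \<restriction> n @ [True])" using in_A_iff[of n] by simp
      moreover have "2 * M (A \<restriction> n) = M (A \<restriction> n @ [False]) + M (A \<restriction> n @ [True])"
        using M(1) unfolding martingale_def by blast
      ultimately show ?thesis using False by simp
    qed
    then show ?case using Suc unfolding A_Suc by simp
  qed
  show ?thesis
  proof
    have "computable_in X path"
      unfolding path_def ext_def bit_def
      by (intro computable_intros computable_compose[OF nd(1)] computable_compose[OF nd(2)])
    then have "decidable_in X (\<lambda>n. bit (path n))"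
      unfolding ext_def bit_def
      by (intro computable_intros computable_compose[OF nd(1)] computable_compose[OF nd(2)])
    then show "A \<le>\<^sub>T X" by (simp add: turing_le_iff_decidable A_def)
    have "limsup (\<lambda>n. ereal (real_of_rat (M (A \<restriction> n)))) \<le> ereal (real_of_rat (M []))"
      using bound by (intro Limsup_bounded) (simp add: of_rat_less_eq)
    then show "A \<notin> success_set M" by (auto simp: success_set_def)
  qed
qed

section \<open>Passing from sets to degrees\<close>

lemma turing_le_uminus: "A \<le>\<^sub>T X \<Longrightarrow> - A \<le>\<^sub>T X"
  unfolding turing_le_iff_decidable by (simp add: decidable_not)

lemma degree_of_le_iff: "degree_of A \<le> degree_of B \<longleftrightarrow> A \<le>\<^sub>T B"
  by transfer (rule refl)

lemma degree_of_surj: "\<exists>A. degree_of A = d"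
  by transfer (auto simp: turing_equiv_def turing_le_refl)

lemma below_zero_jump_null:
  assumes "d < \<zero>'"
  shows "delta02_null (delta02_with_subset_or_cosubset d)"
proof -
  obtain D where d: "d = degree_of D" using degree_of_surj by metis
  have "D \<le>\<^sub>T jump {}" "\<not> jump {} \<le>\<^sub>T D"
    using assms unfolding less_turing_degree_def zero_jump_def d degree_of_le_iff by auto
  then have "delta02_null {A. \<exists>B. infinite B \<and> (B \<subseteq> A \<or> B \<subseteq> - A) \<and> B \<le>\<^sub>T D}"
    by (rule turing_below_jump_null)
  \<comment> \<open>The null class just obtained does not require \<open>A\<close> to be
    \<open>delta02\<close>; nullity passes to subclasses.\<close>
  moreover have "delta02_with_subset_or_cosubset d \<subseteq>
      {A. \<exists>B. infinite B \<and> (B \<subseteq> A \<or> B \<subseteq> - A) \<and> B \<le>\<^sub>T D}"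
    unfolding delta02_with_subset_or_cosubset_def d degree_of_le_iff by blast
  ultimately show ?thesis unfolding delta02_null_def by (meson subset_trans)
qed

text \<open>A set computable from \<open>jump {}\<close> on which the martingale fails belongs to
  the class: it or its complement is infinite, and both are computable from
  \<open>jump {}\<close>.\<close>

lemma almost_s_Ramsey_zero_jump: "almost_s_Ramsey \<zero>'"
  unfolding almost_s_Ramsey_def delta02_null_def
proof clarify
  fix M
  assume "martingale M" "martingale_computable_in (jump {}) M"
    and C: "delta02_with_subset_or_cosubset \<zero>' \<subseteq> success_set M"
  then obtain A where A: "A \<le>\<^sub>T jump {}" "A \<notin> success_set M"
    using computable_martingale_fails by blast
  have "infinite A \<or> infinite (- A)" using finite_compl infinite_UNIV_nat by blast
  then have "\<exists>B. infinite B \<and> (B \<subseteq> A \<or> B \<subseteq> - A) \<and> B \<le>\<^sub>T jump {}"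
    using A(1) turing_le_uminus by blast
  then have "A \<in> delta02_with_subset_or_cosubset \<zero>'"
    using A(1) unfolding delta02_with_subset_or_cosubset_def zero_jump_def degree_of_le_iff
      delta02_def by blast
  then show False using A(2) C by blast
qed

theorem theorem1p5:
  shows "(\<forall>d. d < \<zero>' \<longrightarrow> delta02_null (delta02_with_subset_or_cosubset d)) \<and>
         {d. delta02_degree d \<and> almost_s_Ramsey d} = {\<zero>'}"
proof (intro conjI allI impI)
  show "delta02_null (delta02_with_subset_or_cosubset d)" if "d < \<zero>'" for d
    using that by (rule below_zero_jump_null)
  \<comment> \<open>A \<open>delta02\<close> degree is at most \<open>\<zero>'\<close>, and the
    first conjunct rules out a strict inequality.\<close>
  have "d = \<zero>'" if "delta02_degree d" "almost_s_Ramsey d" for d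
  proof -
    have "d \<le> \<zero>'"
      using that(1) unfolding delta02_degree_def delta02_def zero_jump_def
      by (auto simp: degree_of_le_iff)
    then show ?thesis
      using that(2) below_zero_jump_null unfolding almost_s_Ramsey_def by (auto simp: le_less)
  qed
  moreover have "delta02_degree \<zero>'"
    unfolding delta02_degree_def delta02_def zero_jump_def using turing_le_refl by blast
  ultimately show "{d. delta02_degree d \<and> almost_s_Ramsey d} = {\<zero>'}"
    using almost_s_Ramsey_zero_jump by blast
qed

end
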